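(* Let $V$ be a finite totally ordered set with $|V|=n\geq 5$, identified (via the unique order isomorphism) with $\{0,1,\ldots,n-1\}$ under the natural order, so that $\underline{V}=\underline{n}$. Let $Q$ be a partial quasi-pairing of $V$ and let $T:=\mathrm{Inv}(\underline{n},Q)$. The tournament $T$ is indecomposable if and only if the following four conditions are all satisfied. (C1) The set $\cup Q$ is a transversal of $\mathrm{mc}(\underline{n})$, and $Q$ is an irreducible quasi-pairing of $\cup Q$ (where $\cup Q$ carries the induced order). (C2) $v_Q^+\geq v_Q^-+2$. (C3) For every $v\in\{0,\ldots,n-1\}$, if $\{\{v,v+2\},\{v+1,v+3\}\}\subseteq Q$, then $\hat v_Q\in\{v,v+3\}$. (C4) For every $v\in\{0,\ldots,n-1\}$, if $\{v,v+1\}\in Q$, then $\hat v_Q\in\{v,v+1\}$ and $\{\hat v_Q-1,\hat v_Q+1\}\subseteq\cup Q$ (in particular $\hat v_Q\notin\{0,n-1\}$).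
   Context: All structures are finite. A tournament $T=(V(T),A(T))$ consists of a finite vertex set $V(T)$ and a set $A(T)$ of ordered pairs of distinct vertices (arcs) such that for all $x\neq y$ in $V(T)$, $(x,y)\in A(T)$ if and only if $(y,x)\notin A(T)$. For a totally ordered set $V$, $\underline{V}$ denotes the transitive tournament $(V,\{(x,y)\in V\times V: x<y\})$; when $V=\{0,\ldots,n-1\}$ with the natural order it is denoted $\underline{n}$. For $Q\subseteq \binom{V}{2}$ (a set of unordered pairs of distinct elements), $\mathrm{Inv}(\underline{V},Q)$ is the tournament on $V$ obtained from $\underline{V}$ by reversing every arc $(x,y)$ such that $\{x,y\}\in Q$; $\cup Q$ denotes the union of the pairs in $Q$. A module of a tournament $T$ is a subset $M\subseteq V(T)$ such that for every $v\in V(T)\setminus M$, either $\{v\}\times M\subseteq A(T)$ or $M\times\{v\}\subseteq A(T)$. The trivial modules are $\emptyset$, $V(T)$ and the singletons. $T$ is indecomposable if all its modules are trivial. A co-module of $T$ is a subset $M\subseteq V(T)$ such that $M$ or $V(T)\setminus M$ is a nontrivial module of $T$; it is minimal if it contains no other co-module. $\mathrm{mc}(T)$ denotes the family of minimal co-modules of $T$. A transversal of a family $\mathcal{F}$ of sets is a set $R$ with $R\cap F\neq\emptyset$ for every $F\in\mathcal{F}$. A quasi-pairing of a set $W$ of size $2m+1$ with $m\geq 1$ is a subset $Q\subseteq\binom{W}{2}$ with $|Q|=m+1$ and $\cup Q=W$. A partial quasi-pairing of $V$ is a quasi-pairing of some subset of $V$ (namely of $\cup Q$). In a quasi-pairing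 $Q$ exactly one element, denoted $\hat v_Q$, belongs to two pairs of $Q$ and every other element of $\cup Q$ belongs to exactly one pair; $v_Q^-<v_Q^+$ denote the two elements such that $\{\hat v_Q,v_Q^-\},\{\hat v_Q,v_Q^+\}\in Q$, and $B_Q:=\{\hat v_Q,v_Q^-,v_Q^+\}$. Let $Q_{\mathrm{part}}:=(Q\setminus\{\{\hat v_Q,v_Q^-\},\{\hat v_Q,v_Q^+\}\})\cup\{B_Q\}$, which is a partition of $\cup Q$. An interval of a totally ordered set $X$ is a subset $I\subseteq X$ such that every element of $X\setminus I$ is greater than all the elements of $I$ or smaller than all of them; it is nontrivial if it is neither $\emptyset$, nor a singleton, nor $X$. A partition of a totally ordered set $X$ is irreducible if no nontrivial interval of $X$ is a union of blocks. A quasi-pairing $Q$ of a totally ordered set $X$ is irreducible if the partition $Q_{\mathrm{part}}$ of $X$ is irreducible. *)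

theory Defs
  imports
    "Graph_Theory.Pair_Digraph"
    "HOL-Library.Disjoint_Sets"
    "HOL-Library.Ramsey"
begin

section \<open>Tournaments, modules and co-modules\<close>

locale tournament = pair_digraph T for T :: "'a pair_pre_digraph" +
  assumes arc_iff: "\<lbrakk>x \<in> pverts T; y \<in> pverts T; x \<noteq> y\<rbrakk> \<Longrightarrow>
    (x, y) \<in> parcs T \<longleftrightarrow> (y, x) \<notin> parcs T"

definition transitive_tournament :: "'a::linorder set \<Rightarrow> 'a pair_pre_digraph" where
  "transitive_tournament V = \<lparr>pverts = V, parcs = {(x, y). x \<in> V \<and> y \<in> V \<and> x < y}\<rparr>"

definition Inv :: "'a pair_pre_digraph \<Rightarrow> 'a set set \<Rightarrow> 'a pair_pre_digraph" where
  "Inv T Q = \<lparr>pverts = pverts T,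
    parcs = {(x, y). (x, y) \<in> parcs T \<and> {x, y} \<notin> Q} \<union> {(y, x) | x y. (x, y) \<in> parcs T \<and> {x, y} \<in> Q}\<rparr>"

definition tmodule :: "'a pair_pre_digraph \<Rightarrow> 'a set \<Rightarrow> bool" where
  "tmodule T M \<longleftrightarrow> M \<subseteq> pverts T \<and>
    (\<forall>v \<in> pverts T - M. {v} \<times> M \<subseteq> parcs T \<or> M \<times> {v} \<subseteq> parcs T)"

definition trivial_module :: "'a pair_pre_digraph \<Rightarrow> 'a set \<Rightarrow> bool" where
  "trivial_module T M \<longleftrightarrow> M = {} \<or> M = pverts T \<or> (\<exists>v \<in> pverts T. M = {v})"

definition indecomposable :: "'a pair_pre_digraph \<Rightarrow> bool" where
  "indecomposable T \<longleftrightarrow> (\<forall>M. tmodule T M \<longrightarrow> trivial_module T M)"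

definition nontrivial_module :: "'a pair_pre_digraph \<Rightarrow> 'a set \<Rightarrow> bool" where
  "nontrivial_module T M \<longleftrightarrow> tmodule T M \<and> \<not> trivial_module T M"

definition comodule :: "'a pair_pre_digraph \<Rightarrow> 'a set \<Rightarrow> bool" where
  "comodule T M \<longleftrightarrow> M \<subseteq> pverts T \<and>
    (nontrivial_module T M \<or> nontrivial_module T (pverts T - M))"

definition mc :: "'a pair_pre_digraph \<Rightarrow> 'a set set" where
  "mc T = {M. comodule T M \<and> \<not> (\<exists>N. comodule T N \<and> N \<subset> M)}"

definition transversal :: "'a set set \<Rightarrow> 'a set \<Rightarrow> bool" where
  "transversal F R \<longleftrightarrow> (\<forall>X \<in> F. R \<inter> X \<noteq> {})"


section \<open>Irreducible partitions\<close>

definition interval :: "'a::linorder set \<Rightarrow> 'a set \<Rightarrow> bool" where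
  "interval X I \<longleftrightarrow> I \<subseteq> X \<and> (\<forall>x \<in> X - I. (\<forall>i \<in> I. i < x) \<or> (\<forall>i \<in> I. x < i))"

definition nontrivial_interval :: "'a::linorder set \<Rightarrow> 'a set \<Rightarrow> bool" where
  "nontrivial_interval X I \<longleftrightarrow> interval X I \<and> I \<noteq> {} \<and> \<not> is_singleton I \<and> I \<noteq> X"

definition irreducible_partition :: "'a::linorder set \<Rightarrow> 'a set set \<Rightarrow> bool" where
  "irreducible_partition X P \<longleftrightarrow> partition_on X P \<and>
    \<not> (\<exists>I. nontrivial_interval X I \<and> (\<exists>\<B> \<subseteq> P. I = \<Union>\<B>))"


section \<open>Quasi-pairings\<close>

definition quasi_pairing :: "'a set \<Rightarrow> 'a set set \<Rightarrow> bool" where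
  "quasi_pairing W Q \<longleftrightarrow>
    (\<exists>m\<ge>1. card W = 2 * m + 1 \<and> Q \<subseteq> [W]\<^bsup>2\<^esup> \<and> card Q = m + 1 \<and> \<Union>Q = W)"

definition partial_quasi_pairing :: "'a set \<Rightarrow> 'a set set \<Rightarrow> bool" where
  "partial_quasi_pairing V Q \<longleftrightarrow> (\<exists>W \<subseteq> V. quasi_pairing W Q)"

text \<open>The following five constants are meaningful only when \<open>Q\<close> is a quasi-pairing
  (see the lemmas at the end of the section).\<close>

definition v_hat :: "'a set set \<Rightarrow> 'a" where
  "v_hat Q = (THE v. card {e \<in> Q. v \<in> e} = 2)"

definition v_minus :: "'a::linorder set set \<Rightarrow> 'a" where
  "v_minus Q = Min {w. {v_hat Q, w} \<in> Q}"

definition v_plus :: "'a::linorder set set \<Rightarrow> 'a" where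
  "v_plus Q = Max {w. {v_hat Q, w} \<in> Q}"

definition B_block :: "'a::linorder set set \<Rightarrow> 'a set" where
  "B_block Q = {v_hat Q, v_minus Q, v_plus Q}"

definition Q_part :: "'a::linorder set set \<Rightarrow> 'a set set" where
  "Q_part Q = (Q - {{v_hat Q, v_minus Q}, {v_hat Q, v_plus Q}}) \<union> {B_block Q}"

definition irreducible_quasi_pairing :: "'a::linorder set \<Rightarrow> 'a set set \<Rightarrow> bool" where
  "irreducible_quasi_pairing X Q \<longleftrightarrow> quasi_pairing X Q \<and> irreducible_partition X (Q_part Q)"

lemma quasi_pairing_card_2_ex1:
  assumes "quasi_pairing W Q"
  shows "\<exists>!v. card {e \<in> Q. v \<in> e} = 2"
    and "v \<in> W \<Longrightarrow> card {e \<in> Q. v \<in> e} \<noteq> 2 \<Longrightarrow> card {e \<in> Q. v \<in> e} = 1"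
proof -
  let ?d = "\<lambda>v. card {e \<in> Q. v \<in> e}"
  obtain m where m: "m \<ge> 1" "card W = 2 * m + 1" "Q \<subseteq> [W]\<^bsup>2\<^esup>" "card Q = m + 1" "\<Union>Q = W"
    using assms by (auto simp: quasi_pairing_def)
  have finQ: "finite Q" and finW: "finite W"
    using m by (auto intro: card_ge_0_finite)
  have pos: "?d v \<ge> 1" if "v \<in> W" for v
  proof -
    from that m(5) have "{e \<in> Q. v \<in> e} \<noteq> {}" by auto
    with finQ have "card {e \<in> Q. v \<in> e} > 0" by (subst card_gt_0_iff) simp
    then show ?thesis by linarith
  qed
  have zero: "?d v = 0" if "v \<notin> W" for v
  proof -
    from that m(5) have "{e \<in> Q. v \<in> e} = {}" by auto
    then show ?thesis by (simp only: card.empty)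
  qed
  have "(\<Sum>v\<in>W. ?d v) = 2 * card Q"
  proof (rule sum_multicount[OF finW finQ], intro ballI)
    fix e assume "e \<in> Q"
    with m(3) have "e \<subseteq> W" "card e = 2" by (auto simp: nsets_def)
    moreover from \<open>e \<subseteq> W\<close> have "{v \<in> W. v \<in> e} = e" by auto
    ultimately show "card {v \<in> W. v \<in> e} = 2" by simp
  qed
  then have "(\<Sum>v\<in>W. ?d v - 1) = 1"
    using m pos by (simp add: sum_subtractf_nat)
  then obtain a where a: "a \<in> W" "?d a - 1 = 1" "\<forall>b\<in>W. a \<noteq> b \<longrightarrow> ?d b - 1 = 0"
    using sum_eq_1_iff[OF finW] by auto
  have a2: "?d a = 2" using a(2) by simp
  have one: "?d b = 1" if "b \<in> W" "b \<noteq> a" for b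
    using a(3) pos[of b] that by force
  show "\<exists>!v. ?d v = 2"
  proof (rule ex1I[of _ a])
    show "?d a = 2" by (fact a2)
    show "b = a" if "?d b = 2" for b
      using zero[of b] one[of b] that by fastforce
  qed
  show "?d v = 1" if "v \<in> W" "?d v \<noteq> 2"
    using one[of v] a2 that by blast
qed

lemma quasi_pairing_v:
  fixes Q :: "'a::linorder set set"
  assumes "quasi_pairing W Q"
  shows "{w. {v_hat Q, w} \<in> Q} = {v_minus Q, v_plus Q}" and "v_minus Q < v_plus Q"
proof -
  define h where "h = v_hat Q"
  have "card {e \<in> Q. h \<in> e} = 2"
    unfolding h_def v_hat_def by (rule theI'[OF quasi_pairing_card_2_ex1(1)[OF assms]])
  then obtain e f where ef: "{e \<in> Q. h \<in> e} = {e, f}" "e \<noteq> f"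
    by (auto simp: card_2_iff)
  have Q2: "\<And>e. e \<in> Q \<Longrightarrow> card e = 2"
    using assms by (auto simp: quasi_pairing_def nsets_def)
  have ex: "\<exists>w. e = {h, w}" if "e \<in> Q" "h \<in> e" for e
    using Q2[OF that(1)] that(2) by (auto simp: card_2_iff doubleton_eq_iff)
  have "e \<in> {e \<in> Q. h \<in> e}" "f \<in> {e \<in> Q. h \<in> e}"
    unfolding ef(1) by simp_all
  then obtain x y where xy: "e = {h, x}" "f = {h, y}"
    using ex[of e] ex[of f] by force
  have "{w. {h, w} \<in> Q} = {w. {h, w} \<in> {e \<in> Q. h \<in> e}}" by auto
  also have "\<dots> = {x, y}" unfolding ef(1) xy by (auto simp: doubleton_eq_iff)
  finally have *: "{w. {h, w} \<in> Q} = {x, y}" .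
  have "v_minus Q = min x y" "v_plus Q = max x y"
    using * unfolding v_minus_def v_plus_def h_def by simp_all
  moreover have "x \<noteq> y" using ef(2) xy by blast
  ultimately show "v_minus Q < v_plus Q" "{w. {v_hat Q, w} \<in> Q} = {v_minus Q, v_plus Q}"
    using * unfolding h_def by (auto simp: min_def max_def)
qed

lemma tournament_Inv_transitive:
  fixes V :: "'a::linorder set"
  assumes "finite V"
  shows "tournament (Inv (transitive_tournament V) Q)"
proof -
  have "parcs (Inv (transitive_tournament V) Q) \<subseteq> V \<times> V"
    by (auto simp: Inv_def transitive_tournament_def)
  then have "finite (parcs (Inv (transitive_tournament V) Q))"
    using assms finite_subset by blast
  with assms show ?thesis
    by unfold_locales (auto simp: Inv_def transitive_tournament_def insert_commute)
qed

end

theory Submission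
  imports Defs
begin

text \<open>
  Only the adjacency relation of \<open>Q\<close> on \<open>{0..N}\<close>, \<open>N = n - 1\<close>, matters: \<open>M\<close> is a module iff
  every \<open>v \<notin> M\<close> is \<open>Q\<close>-adjacent to exactly the elements of \<open>M\<close> below it, or exactly to those
  above it. As all degrees except that of \<open>v_hat Q\<close> are at most one, this is very restrictive.

  Sufficiency. Let \<open>M\<close> be a nontrivial module with minimum \<open>a\<close> and maximum \<open>b\<close>. No \<open>Q\<close>-pair joins \<open>M\<close>
  to the outside of \<open>[a, b]\<close>, and every gap (an element of \<open>[a, b] - M\<close>) has a \<open>Q\<close>-neighbour in \<open>M\<close>.
  If \<open>v_hat Q\<close> is not a gap, then \<open>[a, b]\<close> is closed under \<open>Q\<close>, so by irreducibility \<open>a = 0\<close> and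
  \<open>b = N\<close>; inspecting \<open>a + 1\<close> and \<open>b - 1\<close> with (C4) gives \<open>M = {a, b}\<close>, and then \<open>n \<ge> 5\<close> contradicts
  (C2). If \<open>v_hat Q\<close> is a gap adjacent to \<open>a\<close> (or, by reversing the order, to \<open>b\<close>), then (C2)-(C4)
  force \<open>v_hat Q = a + 1\<close> to be the only gap, and \<open>[a + 2, b]\<close> is closed, against irreducibility.

  Necessity. The failure of each condition yields an explicit nontrivial module: a module of the
  transitive tournament whose complement, or which itself, avoids all pairs; the convex hull of a union of blocks; \<open>{v_minus Q, v_plus Q}\<close>; \<open>{v, v + 3}\<close>; or one of \<open>{v, v + 1}\<close>, the two
  elements around \<open>v_hat Q\<close>, the complement of \<open>1\<close> or of \<open>N - 1\<close>.
\<close>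

section \<open>Modules as homogeneous sets\<close>

text \<open>Read \<open>E x y\<close> as \<open>{x, y} \<in> Q\<close>: a graph on
  \<open>{..N}\<close> where \<open>h\<close> has degree at most two and every other vertex at most
  one. Keeping \<open>E\<close> abstract lets the same facts be reused for the reversed
  order.\<close>

locale near_matching =
  fixes N :: nat and E :: "nat \<Rightarrow> nat \<Rightarrow> bool" and h :: nat
  assumes E_sym: "E x y \<Longrightarrow> E y x"
    and E_irrefl: "\<not> E x x"
    and E_le: "E x y \<Longrightarrow> x \<le> N"
    and hat_le: "h \<le> N"
    and E_unique: "E x y \<Longrightarrow> E x z \<Longrightarrow> x \<noteq> h \<Longrightarrow> y = z"
    and E_hat_two: "E h x \<Longrightarrow> E h y \<Longrightarrow> E h z \<Longrightarrow> x = y \<or> x = z \<or> y = z"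
begin

definition covered :: "nat \<Rightarrow> bool" where
  "covered x \<longleftrightarrow> (\<exists>y. E x y)"

definition closed_interval :: "nat \<Rightarrow> nat \<Rightarrow> bool" where
  "closed_interval i j \<longleftrightarrow> i \<le> j \<and> j \<le> N \<and> (\<forall>x\<in>{i..j}. \<forall>y. E x y \<longrightarrow> y \<in> {i..j})"

text \<open>A vertex \<open>v\<close> dominates \<open>x\<close> in the inverted tournament iff
  \<open>E v x \<longleftrightarrow> x < v\<close>, so the two alternatives say that
  \<open>v\<close> dominates all of \<open>M\<close> or is dominated by all of it.\<close>

definition homogeneous :: "nat set \<Rightarrow> bool" where
  "homogeneous M \<longleftrightarrow> M \<subseteq> {..N} \<and>
    (\<forall>v\<in>{..N} - M. (\<forall>x\<in>M. E v x \<longleftrightarrow> x < v) \<or> (\<forall>x\<in>M. E v x \<longleftrightarrow> v < x))"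

lemma E_le2: "E x y \<Longrightarrow> y \<le> N"
  using E_le E_sym by blast

end

section \<open>Sufficiency\<close>

text \<open>The first three \<open>covered\<close> axioms come from the transversal condition.
  \<open>closed_interval_full\<close> is irreducibility; its covered point excludes intervals of
  uncovered points, which are closed vacuously. The last three axioms are (C2), (C3) and
  (C4).\<close>

locale admissible = near_matching +
  assumes N_ge: "4 \<le> N"
    and covered_0: "covered 0"
    and covered_N: "covered N"
    and covered_step: "i < N \<Longrightarrow> covered i \<or> covered (Suc i)"
    and closed_interval_full: "closed_interval i j \<Longrightarrow> x \<in> {i..j} \<Longrightarrow> covered x \<Longrightarrow> i = 0 \<and> j = N"
    and hat_gap: "E h y \<Longrightarrow> \<not> E h (Suc y)"
    and crossing: "E v (v + 2) \<Longrightarrow> E (v + 1) (v + 3) \<Longrightarrow> h = v \<or> h = v + 3"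
    and consecutive: "E v (Suc v) \<Longrightarrow>
      (h = v \<or> h = Suc v) \<and> 1 \<le> h \<and> covered (h - 1) \<and> covered (Suc h)"

text \<open>A hypothetical counterexample, to be refuted. As a locale it can be interpreted on its
  own mirror image.\<close>

locale nontrivial_homogeneous = admissible +
  fixes M :: "nat set" and a b :: nat
  assumes homogeneous_M: "homogeneous M"
    and a_in: "a \<in> M" and b_in: "b \<in> M" and a_less_b: "a < b"
    and M_bounds: "x \<in> M \<Longrightarrow> a \<le> x \<and> x \<le> b"
    and M_not_full: "M \<noteq> {..N}"
begin

lemma b_le: "b \<le> N"
  using homogeneous_M b_in by (auto simp: homogeneous_def)

lemma outside_cases:
  assumes "v \<le> N" "v \<notin> M"
  shows "(\<forall>x\<in>M. E v x \<longleftrightarrow> x < v) \<or> (\<forall>x\<in>M. E v x \<longleftrightarrow> v < x)"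
  using assms homogeneous_M by (auto simp: homogeneous_def)

lemma gap_adjacent:
  assumes "a < g" "g < b" "g \<notin> M"
  shows "E g a \<or> E g b"
  using outside_cases[of g] assms a_in b_in b_le by fastforce

text \<open>A neighbour \<open>v\<close> outside the hull has all of \<open>M\<close> on one side,
  hence is adjacent to all of \<open>M\<close>. So \<open>v = h\<close> is the only neighbour of
  \<open>a\<close> and of \<open>b\<close>, and \<open>Suc a\<close> can be neither in
  \<open>M\<close> (by \<open>hat_gap\<close>) nor a gap; \<open>b = Suc a\<close> also violates
  \<open>hat_gap\<close>.\<close>

lemma no_external_edge:
  assumes "x \<in> M" "E x v"
  shows "a \<le> v \<and> v \<le> b"
proof (rule ccontr)
  assume out: "\<not> ?thesis"
  have vN: "v \<le> N" "v \<notin> M" using E_le2 assms(2) out M_bounds by blast+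
  have vx: "E v x" using E_sym assms by blast
  have "(\<forall>y\<in>M. v < y) \<or> (\<forall>y\<in>M. y < v)"
    using out M_bounds by fastforce
  then have all: "\<forall>y\<in>M. E v y"
    using outside_cases[OF vN] vx assms(1) by (metis order_less_asym)
  then have Eva: "E v a" and Evb: "E v b" using a_in b_in by auto
  have vh: "v = h" using E_unique[OF Eva Evb] a_less_b by auto
  have "a \<noteq> h" "b \<noteq> h" using Eva Evb vh E_irrefl by auto
  then have un: "E a y \<Longrightarrow> y = v" "E b y \<Longrightarrow> y = v" for y
    using E_unique[of a y v] E_unique[of b y v] Eva Evb E_sym by auto
  have "b = Suc a"
  proof (rule ccontr)
    assume "b \<noteq> Suc a"
    then have ab: "a < Suc a" "Suc a < b" using a_less_b by auto
    show False
    proof (cases "Suc a \<in> M")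
      case True
      then have "E h (Suc a)" "E h a" using all vh a_in by auto
      then show False using hat_gap by blast
    next
      case False
      then have "E (Suc a) a \<or> E (Suc a) b" using gap_adjacent ab by blast
      then have "Suc a = v" using un E_sym by blast
      then show False using out ab by auto
    qed
  qed
  then show False using hat_gap Eva Evb vh by blast
qed

text \<open>With \<open>no_external_edge\<close> the hull becomes closed under \<open>E\<close>, and
  one of \<open>a\<close>, \<open>Suc a\<close> is covered, so irreducibility applies.\<close>

lemma not_hull_closed:
  assumes "\<And>g y. \<lbrakk>a < g; g < b; g \<notin> M; E g y\<rbrakk> \<Longrightarrow> a \<le> y \<and> y \<le> b"
  shows "a = 0 \<and> b = N"
proof -
  have "closed_interval a b"
    unfolding closed_interval_def
  proof (intro conjI ballI allI impI)
    fix x y assume x: "x \<in> {a..b}" and xy: "E x y"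
    show "y \<in> {a..b}"
    proof (cases "x \<in> M")
      case True
      then show ?thesis using no_external_edge xy by auto
    next
      case False
      then have "a < x" "x < b" using x a_in b_in by (auto simp: less_le)
      then show ?thesis using assms False xy by auto
    qed
  qed (use a_less_b b_le in auto)
  moreover have "covered a \<or> covered (Suc a)"
    using covered_step a_less_b b_le by auto
  ultimately show ?thesis
    using closed_interval_full[of a b a] closed_interval_full[of a b "Suc a"] a_less_b by auto
qed

lemma ex_gap: "\<exists>g. a < g \<and> g < b \<and> g \<notin> M"
proof (rule ccontr)
  assume *: "\<not> ?thesis"
  \<comment> \<open>Without gaps the premise of \<open>not_hull_closed\<close> holds
    vacuously.\<close>
  then have "a = 0 \<and> b = N" by (intro not_hull_closed) blast
  then have "M = {..N}"
    using * M_bounds a_in b_in by (auto simp: set_eq_iff) (metis gr0I le_neq_implies_less)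
  then show False using M_not_full by simp
qed

text \<open>A gap is adjacent to every element of \<open>M\<close> on one of its sides; having
  degree at most one, it finds only the endpoint there.\<close>

lemma gap_types:
  assumes "a < g" "g < b" "g \<notin> M" "g \<noteq> h"
  shows "(E g a \<and> (\<forall>x\<in>M. x < g \<longrightarrow> x = a)) \<or> (E g b \<and> (\<forall>x\<in>M. g < x \<longrightarrow> x = b))"
  using outside_cases[of g] assms a_in b_in b_le E_unique
  by (metis less_imp_le less_le_trans)

text \<open>Otherwise every gap has its only neighbour in \<open>{a, b}\<close>, so the hull is
  everything. The rest shows \<open>M = {a, b}\<close> and then counts the neighbours of
  \<open>a\<close> and \<open>b\<close>.\<close>

lemma hat_in_gap: "a < h \<and> h < b \<and> h \<notin> M"
proof (rule ccontr)
  assume h: "\<not> ?thesis"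
  have "a = 0 \<and> b = N"
  proof (rule not_hull_closed)
    fix g y assume g: "a < g" "g < b" "g \<notin> M" "E g y"
    then have "g \<noteq> h" using h by auto
    moreover have "E g a \<or> E g b" using gap_adjacent g by blast
    ultimately show "a \<le> y \<and> y \<le> b" using E_unique g a_less_b by (metis less_or_eq_imp_le)
  qed
  then have a0: "a = 0" and bN: "b = N" by auto
  have gh: "\<lbrakk>a < g; g < b; g \<notin> M\<rbrakk> \<Longrightarrow> g \<noteq> h" for g using h by auto
  \<comment> \<open>By (C4) the hat would be \<open>a = 0\<close> or the gap \<open>Suc a\<close>;
    the first violates \<open>1 \<le> h\<close>. For \<open>nb\<close> the bound \<open>N\<close>
    plays the same role.\<close>
  have na: "\<not> E a (Suc a)" if "Suc a \<notin> M"
  proof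
    assume *: "E a (Suc a)"
    have "Suc a < b" using a_less_b b_in that by (metis Suc_lessI)
    then have "h \<noteq> Suc a" using gh that by auto
    then show False using consecutive[OF *] a0 by auto
  qed
  have nb: "\<not> E (b - 1) b" if "b - 1 \<notin> M"
  proof
    assume *: "E (b - 1) b"
    have "b - 1 \<noteq> a" using a_in that by blast
    then have ab: "a < b - 1" using a_less_b by auto
    have "b - 1 < b" using a_less_b by auto
    then have "h \<noteq> b - 1" using gh[OF ab _ that] by metis
    moreover have "\<not> covered (Suc b)" using bN E_le by (fastforce simp: covered_def)
    ultimately show False using consecutive[of "b - 1"] * ab by auto
  qed
  obtain g where g: "a < g" "g < b" "g \<notin> M" using ex_gap by blast
  \<comment> \<open>One gap adjacent to \<open>a\<close> makes \<open>Suc a\<close> a gap. Not being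
    adjacent to \<open>a\<close>, it is adjacent to \<open>b\<close> and has no element of
    \<open>M\<close> above it except \<open>b\<close>. The other case is the mirror image.\<close>
  have M2: "M = {a, b}"
    using gap_types[OF g gh[OF g]]
  proof
    assume l: "E g a \<and> (\<forall>x\<in>M. x < g \<longrightarrow> x = a)"
    then have s: "Suc a \<notin> M" using g by (metis Suc_lessI lessI less_irrefl_nat)
    have sb: "Suc a < b" using g by auto
    have "\<not> E (Suc a) a" using na s E_sym by blast
    then have "\<forall>x\<in>M. Suc a < x \<longrightarrow> x = b"
      using gap_types[of "Suc a"] s sb gh by auto
    then show "M = {a, b}" using M_bounds a_in b_in s
      by (auto simp: set_eq_iff) (metis Suc_lessI le_neq_implies_less)
  next
    assume r: "E g b \<and> (\<forall>x\<in>M. g < x \<longrightarrow> x = b)"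
    have s: "b - 1 \<notin> M"
    proof
      assume "b - 1 \<in> M"
      moreover have "g \<le> b - 1" "b - 1 \<noteq> b" using g by auto
      ultimately show False using r g le_neq_implies_less by metis
    qed
    have sb: "a < b - 1" "b - 1 < b" using g by auto
    then have "\<forall>x\<in>M. x < b - 1 \<longrightarrow> x = a"
      using gap_types[of "b - 1"] s nb gh by auto
    then have "x \<in> M \<Longrightarrow> x = a \<or> x = b" for x using M_bounds[of x] s
      by (metis One_nat_def Suc_pred' add_cancel_left_left diff_is_0_eq le_antisym less_Suc_eq less_or_eq_imp_le linorder_not_less nat_less_le not_gr_zero)
    then show "M = {a, b}" using a_in b_in by auto
  qed
  have ab4: "a + 4 \<le> b" using a0 bN N_ge by simp
  have adj: "E a g \<or> E b g" if "a < g" "g < b" for g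
    using gap_adjacent[of g] that M2 E_sym by auto
  have "E b (Suc a)" using adj[of "Suc a"] na M2 ab4 by auto
  have "a < b - 1" "b - 1 < b" using ab4 by auto
  then have "E a (b - 1)" using adj[of "b - 1"] nb M2 ab4 E_sym[of b "b - 1"] by auto
  \<comment> \<open>Every interior vertex is adjacent to \<open>a\<close> or \<open>b\<close>.
    Placing \<open>a + 2\<close> and then \<open>a + 3\<close> would give \<open>b\<close> or
    \<open>a\<close> two consecutive neighbours, or make both \<open>a\<close> and \<open>b\<close>
    the hat.\<close>
  have "\<not> E b (a + 2)"
  proof
    assume *: "E b (a + 2)"
    then have "h = b" using E_unique[of b "a + 2" "Suc a"] \<open>E b (Suc a)\<close> by auto
    then show False using hat_gap[of "Suc a"] * \<open>E b (Suc a)\<close> by auto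
  qed
  then have a2: "E a (a + 2)" using adj[of "a + 2"] ab4 by auto
  moreover have "a + 2 \<noteq> b - 1" using ab4 by linarith
  ultimately have ha: "h = a" using E_unique[of a "a + 2" "b - 1"] \<open>E a (b - 1)\<close> by auto
  have "E a (a + 3) \<or> E b (a + 3)" using adj[of "a + 3"] ab4 by auto
  then show False
  proof
    assume "E a (a + 3)"
    then show False using hat_gap[of "a + 2"] a2 ha by (auto simp: numeral_eq_Suc)
  next
    assume "E b (a + 3)"
    then have "h = b" using E_unique[of b "a + 3" "Suc a"] \<open>E b (Suc a)\<close> by auto
    then show False using ha a_less_b by auto
  qed
qed

text \<open>Since \<open>h\<close> is the only neighbour of \<open>a\<close>, every other gap is
  adjacent to \<open>b\<close>. This forces \<open>h = Suc a\<close> to be the only gap, and the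
  rest of the hull is then a proper closed interval.\<close>

lemma hat_not_adjacent_min: "\<not> E h a"
proof
  assume Eha: "E h a"
  have h: "a < h" "h < b" "h \<notin> M" using hat_in_gap by auto
  have all: "E h x \<longleftrightarrow> x < h" if "x \<in> M" for x
    using outside_cases[OF hat_le h(3)] h(1) Eha a_in that by (metis order_less_asym)
  have Na: "y = h" if "E a y" for y
    using E_unique[of a y h] that E_sym Eha h by blast
  have right: "E g b \<and> (\<forall>x\<in>M. g < x \<longrightarrow> x = b)" if "a < g" "g < b" "g \<notin> M" "g \<noteq> h" for g
    using gap_types[OF that] Na E_sym that by blast
  have before: "x = a" if "x \<in> M" "x < h" for x
  proof (rule ccontr)
    assume "x \<noteq> a"
    then have ax: "a < x" using M_bounds that by (metis le_neq_implies_less)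
    show False
    proof (cases "Suc a \<in> M")
      case True
      then have "E h (Suc a)" using all ax that by auto
      then show False using hat_gap Eha by blast
    next
      case False
      then have sx: "Suc a < x" using ax that(1) by (metis Suc_lessI)
      then have "x = b" using right[of "Suc a"] False that h by auto
      then show False using that h by auto
    qed
  qed
  \<comment> \<open>Otherwise \<open>Suc a\<close> uses up the only place at \<open>b\<close>, so
    nothing but \<open>h\<close> lies between \<open>Suc a\<close> and \<open>b\<close>. This leaves
    exactly the crossing pattern of (C3) with the hat at \<open>a + 2\<close>.\<close>
  have ha: "h = Suc a"
  proof (rule ccontr)
    assume "h \<noteq> Suc a"
    then have s: "Suc a < h" using h by auto
    then have sM: "Suc a \<notin> M" using before by fastforce
    then have r: "E (Suc a) b" "\<forall>x\<in>M. Suc a < x \<longrightarrow> x = b" using right[of "Suc a"] s h by auto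
    have only: "g = h" if "Suc a < g" "g < b" for g
    proof (rule ccontr)
      assume "g \<noteq> h"
      moreover have "g \<notin> M" using r that by auto
      ultimately have "E g b" using right[of g] that by auto
      then have "g = Suc a" using E_unique[of b g "Suc a"] r E_sym h by blast
      then show False using that by auto
    qed
    have h2: "h = a + 2" using only[of "a + 2"] s h by auto
    have b3: "b = a + 3" using only[of "a + 3"] h2 h by (cases "a + 3 < b") auto
    have "E a (a + 2)" "E (a + 1) (a + 3)" using E_sym[OF Eha] r h2 b3 by auto
    then show False using crossing h2 by fastforce
  qed
  have cov: "covered (a + 2)"
    using consecutive[of a] Eha E_sym ha by auto
  \<comment> \<open>A second gap would make \<open>b - 1\<close> a gap adjacent to \<open>b\<close>;
    (C4) then puts the hat at \<open>b - 1\<close> or \<open>b\<close>, although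
    \<open>h < g < b\<close>.\<close>
  have gap: "g \<in> M" if "a < g" "g \<le> b" "g \<noteq> h" for g
  proof (rule ccontr)
    assume g: "g \<notin> M"
    then have gb: "g < b" using that b_in by (metis le_neq_implies_less)
    then have r: "\<forall>x\<in>M. g < x \<longrightarrow> x = b" using right that g by auto
    have *: "b - 1 \<notin> M"
    proof
      assume m: "b - 1 \<in> M"
      then have "g \<noteq> b - 1" using g by auto
      then have "g < b - 1" using gb by auto
      then have "b - 1 = b" using r m by blast
      then show False using gb by linarith
    qed
    have "h < g" using that ha by auto
    then have "a < b - 1" "b - 1 < b" "b - 1 \<noteq> h" using gb h by auto
    then have "E (b - 1) b" using right * by auto
    then have "E (b - 1) (Suc (b - 1))" using gb by auto
    then have "h = b - 1 \<or> h = Suc (b - 1)" using consecutive by blast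
    then show False using \<open>h < g\<close> gb by auto
  qed
  have "closed_interval (a + 2) b"
    unfolding closed_interval_def
  proof (intro conjI ballI allI impI)
    show "a + 2 \<le> b" using h ha by auto
    fix x y assume x: "x \<in> {a + 2..b}" and xy: "E x y"
    then have xM: "x \<in> M" using gap[of x] ha by auto
    have "a \<le> y" "y \<le> b" using no_external_edge[OF xM xy] by auto
    moreover have "y \<noteq> a" using Na[of x] E_sym[OF xy] x ha by auto
    moreover have "y \<noteq> h" using all[OF xM] E_sym[OF xy] x ha by auto
    ultimately show "y \<in> {a + 2..b}" using ha by auto
  qed (fact b_le)
  then have "a + 2 = 0" using closed_interval_full[of "a + 2" b "a + 2"] cov h ha by auto
  then show False by simp
qed

text \<open>All axioms are invariant under \<open>x\<close> to \<open>N - x\<close>. The bounds in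
  the reflected relation are needed because truncated subtraction sends every number above
  \<open>N\<close> to \<open>0\<close>.\<close>

lemma reflected:
  "nontrivial_homogeneous N (\<lambda>x y. x \<le> N \<and> y \<le> N \<and> E (N - x) (N - y)) (N - h)
    ((\<lambda>x. N - x) ` M) (N - b) (N - a)"
proof -
  let ?E = "\<lambda>x y. x \<le> N \<and> y \<le> N \<and> E (N - x) (N - y)"
  interpret R: near_matching N ?E "N - h"
  proof
    show "x = y \<or> x = z \<or> y = z" if "?E (N - h) x" "?E (N - h) y" "?E (N - h) z" for x y z
      using E_hat_two[of "N - x" "N - y" "N - z"] that hat_le by auto
    show "y = z" if "?E x y" "?E x z" "x \<noteq> N - h" for x y z
      using E_unique[of "N - x" "N - y" "N - z"] that hat_le
      by (metis diff_diff_cancel)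
  qed (blast intro: E_sym, simp_all add: E_irrefl)
  have cov: "R.covered x \<longleftrightarrow> x \<le> N \<and> covered (N - x)" for x
  proof
    assume "x \<le> N \<and> covered (N - x)"
    then obtain y where "x \<le> N" "E (N - x) y" by (auto simp: covered_def)
    then have "?E x (N - y)" using E_le2[of "N - x" y] by auto
    then show "R.covered x" unfolding R.covered_def by blast
  qed (auto simp: R.covered_def covered_def)
  have M_le: "x \<le> N" if "x \<in> M" for x using that M_bounds b_le by fastforce
  show ?thesis
  proof
    show "4 \<le> N" by (fact N_ge)
    show "R.covered 0" "R.covered N" using cov covered_0 covered_N by auto
    show "R.covered i \<or> R.covered (Suc i)" if "i < N" for i
    proof -
      have "N - Suc i < N" "Suc (N - Suc i) = N - i" using that by auto
      then show ?thesis using covered_step[of "N - Suc i"] that cov by auto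
    qed
    show "i = 0 \<and> j = N" if c: "R.closed_interval i j" "x \<in> {i..j}" "R.covered x" for i j x
    proof -
      have ij: "i \<le> j" "j \<le> N" using c(1) unfolding R.closed_interval_def by blast+
      have "closed_interval (N - j) (N - i)"
        unfolding closed_interval_def
      proof (intro conjI ballI allI impI)
        fix u w assume u: "u \<in> {N - j..N - i}" and uw: "E u w"
        then have "?E (N - u) (N - w)" "N - u \<in> {i..j}"
          using E_le[OF uw] E_le2[OF uw] ij by auto
        then have "N - w \<in> {i..j}" using c(1) unfolding R.closed_interval_def by blast
        then show "w \<in> {N - j..N - i}" using E_le2[OF uw] by auto
      qed (use ij in auto)
      moreover have "N - x \<in> {N - j..N - i}" "covered (N - x)" using c(2,3) cov by auto
      ultimately show ?thesis using closed_interval_full[of "N - j" "N - i" "N - x"] ij by auto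
    qed
    show "\<not> ?E (N - h) (Suc y)" if "?E (N - h) y" for y
    proof
      assume "?E (N - h) (Suc y)"
      then have "E h (N - Suc y)" "E h (Suc (N - Suc y))"
        using that hat_le by (auto simp: Suc_diff_Suc)
      then show False using hat_gap by blast
    qed
    show "N - h = v \<or> N - h = v + 3" if "?E v (v + 2)" "?E (v + 1) (v + 3)" for v
    proof -
      define u where "u = N - (v + 3)"
      have eqs: "N - v = u + 3" "N - (v + 1) = u + 2" "N - (v + 2) = u + 1" "N - (v + 3) = u" "v + 3 \<le> N"
        using that by (auto simp: u_def)
      then have "E u (u + 2)" "E (u + 1) (u + 3)" using that E_sym by auto
      then have "h = u \<or> h = u + 3" by (rule crossing)
      then show ?thesis using eqs by linarith
    qed
    show "(N - h = v \<or> N - h = Suc v) \<and> 1 \<le> N - h \<and> R.covered (N - h - 1) \<and> R.covered (Suc (N - h))"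
      if "?E v (Suc v)" for v
    proof -
      define u where "u = N - Suc v"
      have eqs: "N - v = Suc u" "Suc v \<le> N" using that by (auto simp: u_def)
      then have "E u (Suc u)" using that E_sym by (auto simp: u_def)
      from consecutive[OF this]
      have c: "h = u \<or> h = Suc u" "1 \<le> h" "covered (h - 1)" "covered (Suc h)" by auto
      \<comment> \<open>Guarantees that the subtractions below are not truncated, so that the two
        neighbours of \<open>h\<close> are exchanged.\<close>
      have hN: "Suc h \<le> N" using c(4) E_le by (auto simp: covered_def)
      have "N - (N - h - 1) = Suc h" "N - Suc (N - h) = h - 1" using hN c(2) by auto
      then show ?thesis using c hN eqs by (auto simp: cov)
    qed
    show "R.homogeneous ((\<lambda>x. N - x) ` M)"
      unfolding R.homogeneous_def
    proof (intro conjI ballI)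
      fix v assume v: "v \<in> {..N} - (\<lambda>x. N - x) ` M"
      have "N - v \<notin> M"
      proof
        assume "N - v \<in> M"
        then have "N - (N - v) \<in> (\<lambda>x. N - x) ` M" by blast
        then show False using v by auto
      qed
      then have "(\<forall>x\<in>M. E (N - v) x \<longleftrightarrow> x < N - v) \<or> (\<forall>x\<in>M. E (N - v) x \<longleftrightarrow> N - v < x)"
        by (intro outside_cases) auto
      then show "(\<forall>x\<in>(\<lambda>x. N - x) ` M. ?E v x \<longleftrightarrow> x < v) \<or> (\<forall>x\<in>(\<lambda>x. N - x) ` M. ?E v x \<longleftrightarrow> v < x)"
      proof (elim disjE)
        assume "\<forall>x\<in>M. E (N - v) x \<longleftrightarrow> x < N - v"
        then have "\<forall>x\<in>(\<lambda>x. N - x) ` M. ?E v x \<longleftrightarrow> v < x"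
          using v M_le by fastforce
        then show ?thesis ..
      next
        assume "\<forall>x\<in>M. E (N - v) x \<longleftrightarrow> N - v < x"
        then have "\<forall>x\<in>(\<lambda>x. N - x) ` M. ?E v x \<longleftrightarrow> x < v"
          using v M_le by fastforce
        then show ?thesis ..
      qed
    qed auto
    show "N - b < N - a" using a_less_b b_le by auto
    show "N - b \<le> x \<and> x \<le> N - a" if "x \<in> (\<lambda>x. N - x) ` M" for x
      using that M_bounds by (fastforce intro: diff_le_mono2)
    show "(\<lambda>x. N - x) ` M \<noteq> {..N}"
    proof
      assume *: "(\<lambda>x. N - x) ` M = {..N}"
      have "x \<in> M" if "x \<le> N" for x
      proof -
        have "N - x \<in> (\<lambda>x. N - x) ` M" using * that by auto
        then obtain y where "y \<in> M" "N - x = N - y" by auto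
        then show ?thesis using M_le[of y] that by (metis diff_diff_cancel)
      qed
      then have "M = {..N}" using M_le by auto
      then show False using M_not_full by simp
    qed
  qed (use a_in b_in in auto)
qed

text \<open>The hat is a gap, hence adjacent to \<open>a\<close> or \<open>b\<close>; the second
  case is the first one reflected.\<close>

lemma contradictory: False
proof -
  interpret R: nontrivial_homogeneous N "\<lambda>x y. x \<le> N \<and> y \<le> N \<and> E (N - x) (N - y)" "N - h"
    "(\<lambda>x. N - x) ` M" "N - b" "N - a"
    by (fact reflected)
  have "\<not> E h b" using R.hat_not_adjacent_min b_le hat_le by auto
  then show False using hat_not_adjacent_min gap_adjacent hat_in_gap by blast
qed

end

context admissible
begin

lemma homogeneous_trivial:
  assumes "homogeneous M" "x \<in> M" "y \<in> M" "x \<noteq> y"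
  shows "M = {..N}"
proof (rule ccontr)
  assume "M \<noteq> {..N}"
  have fin: "finite M" using assms(1) finite_subset by (auto simp: homogeneous_def)
  have ne: "M \<noteq> {}" using assms(2) by blast
  have "Min M \<noteq> Max M"
    using assms(2-4) fin by (metis Max_ge Min_le le_antisym)
  moreover have "Min M \<le> Max M" using fin assms(2) by (meson Max_ge Min_le order_trans)
  ultimately have "Min M < Max M" by simp
  then interpret nontrivial_homogeneous N E h M "Min M" "Max M"
    using assms(1) fin \<open>M \<noteq> {..N}\<close> Min_in[OF fin ne] Max_in[OF fin ne] by unfold_locales auto
  show False by (fact contradictory)
qed

end

section \<open>Necessity\<close>

context near_matching
begin

definition prime :: bool where
  "prime \<longleftrightarrow> (\<forall>M. homogeneous M \<longrightarrow> M = {} \<or> M = {..N} \<or> (\<exists>v\<in>{..N}. M = {v}))"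

lemma not_prime:
  assumes "homogeneous M" "x \<in> M" "y \<in> M" "x \<noteq> y" "z \<le> N" "z \<notin> M"
  shows "\<not> prime"
  using assms unfolding prime_def by (metis atMost_iff empty_iff singletonD)

text \<open>Two consecutive vertices whose only neighbour is \<open>h\<close> form a module, and
  \<open>h\<close> lies outside it.\<close>

lemma prime_hat_gap:
  assumes "prime" "2 \<le> N" "E h p"
  shows "\<not> E h (Suc p)"
proof
  assume s: "E h (Suc p)"
  have ph: "p \<noteq> h" "Suc p \<noteq> h" using assms(3) s E_irrefl by auto
  have un: "E p v \<longleftrightarrow> v = h" "E (Suc p) v \<longleftrightarrow> v = h" for v
    using E_unique[of p v h] E_unique[of "Suc p" v h] E_sym[OF assms(3)] E_sym[OF s] ph by auto
  have adj: "E v p \<longleftrightarrow> v = h" "E v (Suc p) \<longleftrightarrow> v = h" for v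
    using un[of v] E_sym by blast+
  have "homogeneous {p, Suc p}"
    unfolding homogeneous_def
  proof (intro conjI ballI)
    show "{p, Suc p} \<subseteq> {..N}" using E_le2[OF assms(3)] E_le2[OF s] by simp
    fix v assume "v \<in> {..N} - {p, Suc p}"
    then have "v < p \<or> Suc p < v" by auto
    then show "(\<forall>x\<in>{p, Suc p}. E v x \<longleftrightarrow> x < v) \<or> (\<forall>x\<in>{p, Suc p}. E v x \<longleftrightarrow> v < x)"
      by (cases "v = h") (auto simp: adj)
  qed
  then show False
    using not_prime[of "{p, Suc p}" p "Suc p" h] ph hat_le assms(1) by auto
qed

text \<open>If neither \<open>v\<close> nor \<open>v + 3\<close> is the hat, they form a module: of
  the two, \<open>v + 1\<close> is adjacent just to the upper one and \<open>v + 2\<close> just to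
  the lower one.\<close>

lemma prime_crossing:
  assumes "prime" "E v (v + 2)" "E (v + 1) (v + 3)"
  shows "h = v \<or> h = v + 3"
proof (rule ccontr)
  assume h: "\<not> ?thesis"
  have un: "E u v \<longleftrightarrow> u = v + 2" "E u (v + 3) \<longleftrightarrow> u = v + 1" for u
    using E_unique[of v u "v + 2"] E_unique[of "v + 3" u "v + 1"] assms(2,3) E_sym[of u] E_sym[of _ u]
      E_sym[OF assms(3)] E_sym[OF assms(2)] h by blast+
  have "homogeneous {v, v + 3}"
    unfolding homogeneous_def
  proof (intro conjI ballI)
    show "{v, v + 3} \<subseteq> {..N}" using E_le2[OF assms(3)] by simp
    fix u assume "u \<in> {..N} - {v, v + 3}"
    then consider "u < v \<or> v + 3 < u" | "u = v + 1" | "u = v + 2" by force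
    then show "(\<forall>x\<in>{v, v + 3}. E u x \<longleftrightarrow> x < u) \<or> (\<forall>x\<in>{v, v + 3}. E u x \<longleftrightarrow> u < x)"
      by cases (auto simp: un)
  qed
  then show False
    using not_prime[of "{v, v + 3}" v "v + 3" "v + 1"] E_le[OF assms(3)] assms(1) by auto
qed

lemma homogeneous_remove_source_or_sink:
  assumes "v \<le> N" "(\<forall>x\<in>{..N} - {v}. E v x \<longleftrightarrow> x < v) \<or> (\<forall>x\<in>{..N} - {v}. E v x \<longleftrightarrow> v < x)"
  shows "homogeneous ({..N} - {v})"
  using assms unfolding homogeneous_def by auto

lemma homogeneous_around:
  assumes "\<And>u. E u v \<longleftrightarrow> u = Suc v" "\<not> covered (v + 2)" "v + 2 \<le> N"
  shows "homogeneous {v, v + 2}"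
  unfolding homogeneous_def
proof (intro conjI ballI)
  show "{v, v + 2} \<subseteq> {..N}" using assms by simp
  have nE: "\<not> E u (Suc (Suc v))" for u using assms(2) E_sym by (auto simp: covered_def numeral_2_eq_2)
  fix u assume "u \<in> {..N} - {v, v + 2}"
  then consider "u < v \<or> v + 2 < u" | "u = v + 1" by force
  then show "(\<forall>x\<in>{v, v + 2}. E u x \<longleftrightarrow> x < u) \<or> (\<forall>x\<in>{v, v + 2}. E u x \<longleftrightarrow> u < x)"
    by cases (auto simp: assms(1) nE)
qed

lemma homogeneous_around':
  assumes "\<And>u. E u (v + 2) \<longleftrightarrow> u = Suc v" "\<not> covered v" "v + 2 \<le> N"
  shows "homogeneous {v, v + 2}"
  unfolding homogeneous_def
proof (intro conjI ballI)
  show "{v, v + 2} \<subseteq> {..N}" using assms by simp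
  have nE: "\<not> E u v" for u using assms(2) E_sym unfolding covered_def by blast
  fix u assume "u \<in> {..N} - {v, v + 2}"
  then consider "u < v \<or> v + 2 < u" | "u = v + 1" by force
  then show "(\<forall>x\<in>{v, v + 2}. E u x \<longleftrightarrow> x < u) \<or> (\<forall>x\<in>{v, v + 2}. E u x \<longleftrightarrow> u < x)"
    by cases (use assms(1) nE in auto)
qed

text \<open>Each failure leaves a module: the pair itself when it misses the hat, the complement of
  a source or sink next to an end of the order, or the two vertices around \<open>h\<close> when one
  of them is uncovered.\<close>

lemma prime_consecutive:
  assumes prime and N: "2 \<le> N" and e: "E v (Suc v)"
  shows "(h = v \<or> h = Suc v) \<and> 1 \<le> h \<and> covered (h - 1) \<and> covered (Suc h)"
proof -
  have vN: "Suc v \<le> N" using E_le2[OF e] .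
  have left: "E u v \<longleftrightarrow> u = Suc v" if "h \<noteq> v" for u
    using E_unique[OF _ e, of u] e that E_sym by blast
  have right: "E u (Suc v) \<longleftrightarrow> u = v" if "h \<noteq> Suc v" for u
    using E_unique[OF _ E_sym[OF e], of u] e that E_sym by blast
  have cov: "covered v" "covered (Suc v)" using e E_sym unfolding covered_def by blast+
  have h: "h = v \<or> h = Suc v"
  proof (rule ccontr)
    assume n: "\<not> ?thesis"
    have "homogeneous {v, Suc v}"
      unfolding homogeneous_def
    proof (intro conjI ballI)
      fix u assume "u \<in> {..N} - {v, Suc v}"
      then have "u < v \<or> Suc v < u" by auto
      then show "(\<forall>x\<in>{v, Suc v}. E u x \<longleftrightarrow> x < u) \<or> (\<forall>x\<in>{v, Suc v}. E u x \<longleftrightarrow> u < x)"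
        using left right n by auto
    qed (use vN in auto)
    moreover obtain z where "z \<le> N" "z \<notin> {v, Suc v}"
    proof (cases "v = 0")
      case True
      then show ?thesis using that[of 2] N by auto
    next
      case False
      then show ?thesis using that[of 0] by auto
    qed
    ultimately show False using not_prime[of "{v, Suc v}" v "Suc v" z] assms(1) by auto
  qed
  then show ?thesis
  proof
    assume hv: "h = v"
    have r: "E u (Suc v) \<longleftrightarrow> u = v" for u using right hv by auto
    have r': "E (Suc v) u \<longleftrightarrow> u = v" for u using r E_sym by blast
    have "h \<noteq> 0"
    proof
      assume "h = 0"
      \<comment> \<open>The only reversed arc at \<open>1\<close> is the one from \<open>0\<close>,
        which makes \<open>1\<close> a source.\<close>
      then have "homogeneous ({..N} - {1})"
        using hv r' vN by (intro homogeneous_remove_source_or_sink) auto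
      then show False using not_prime[of "{..N} - {1}" 0 2 1] N assms(1) by auto
    qed
    moreover have "covered (h - 1)"
    proof (rule ccontr)
      assume n: "\<not> covered (h - 1)"
      have s: "Suc v = h - 1 + 2" "v = Suc (h - 1)" using \<open>h \<noteq> 0\<close> hv by auto
      have "homogeneous {h - 1, h - 1 + 2}"
        by (rule homogeneous_around') (use r s n vN in metis)+
      moreover have "h - 1 \<noteq> h - 1 + 2" "h \<notin> {h - 1, h - 1 + 2}" using \<open>h \<noteq> 0\<close> by auto
      ultimately show False
        using not_prime[of "{h - 1, h - 1 + 2}" "h - 1" "h - 1 + 2" h] hat_le assms(1) by blast
    qed
    ultimately show ?thesis using hv cov by auto
  next
    assume hv: "h = Suc v"
    have l: "E u v \<longleftrightarrow> u = Suc v" for u using left hv by auto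
    have l': "E v u \<longleftrightarrow> u = Suc v" for u using l E_sym by blast
    have "covered (Suc h)"
    proof (rule ccontr)
      assume n: "\<not> covered (Suc h)"
      show False
      proof (cases "h = N")
        case True
        then have v: "N = Suc v" using hv by simp
        \<comment> \<open>The only reversed arc at \<open>v = N - 1\<close> is the one to
          \<open>N\<close>, which makes \<open>v\<close> a sink.\<close>
        have "\<forall>x\<in>{..N} - {v}. E v x \<longleftrightarrow> v < x" unfolding l' using v by auto
        then have "homogeneous ({..N} - {v})"
          using v by (intro homogeneous_remove_source_or_sink) simp_all
        moreover have "0 \<noteq> v" "v \<noteq> N" using v N by auto
        ultimately show False using not_prime[of "{..N} - {v}" N 0 v] v assms(1) by simp
      next
        case False
        have "\<not> covered (v + 2)" "v + 2 \<le> N" using n hv False hat_le by simp_all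
        then have "homogeneous {v, v + 2}" by (rule homogeneous_around[OF l])
        then show False using not_prime[of "{v, v + 2}" v "v + 2" "Suc v"] vN assms(1) by auto
      qed
    qed
    then show ?thesis using hv cov by auto
  qed
qed

end

section \<open>Minimal co-modules of the transitive tournament\<close>

lemma tmodule_transitive_iff:
  fixes n :: nat
  shows
  "tmodule (transitive_tournament {0..<n}) M \<longleftrightarrow>
    M \<subseteq> {..<n} \<and> (\<forall>v\<in>{..<n} - M. (\<forall>x\<in>M. v < x) \<or> (\<forall>x\<in>M. x < v))"
  unfolding tmodule_def transitive_tournament_def
  by (simp add: subset_iff atLeast0LessThan) blast

lemma not_comodule_empty: "\<not> comodule T {}"
  by (auto simp: comodule_def nontrivial_module_def trivial_module_def)

text \<open>The complement is not a module since \<open>i\<close> separates \<open>0\<close> from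
  \<open>Suc i\<close>. This gives the minimality of \<open>{i, Suc i}\<close> below.\<close>

lemma not_comodule_interior:
  assumes "0 < i" "Suc i < n"
  shows "\<not> comodule (transitive_tournament {0..<n}) {i}"
proof -
  have "\<not> tmodule (transitive_tournament {0..<n}) ({0..<n} - {i})"
  proof
    assume "tmodule (transitive_tournament {0..<n}) ({0..<n} - {i})"
    then have "(\<forall>x\<in>{0..<n} - {i}. i < x) \<or> (\<forall>x\<in>{0..<n} - {i}. x < i)"
      using assms by (auto simp: tmodule_transitive_iff)
    moreover have "0 \<in> {0..<n} - {i}" "Suc i \<in> {0..<n} - {i}" using assms by auto
    ultimately show False using assms by (meson not_less_zero Suc_n_not_le_n less_or_eq_imp_le)
  qed
  then show ?thesis
    by (auto simp: comodule_def nontrivial_module_def trivial_module_def transitive_tournament_def)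
qed

lemma end_in_mc:
  fixes n :: nat
  assumes "3 \<le> n" "i = 0 \<or> i = n - 1"
  shows "{i} \<in> mc (transitive_tournament {0..<n})"
proof -
  let ?M = "{0..<n} - {i}"
  have "tmodule (transitive_tournament {0..<n}) ?M"
    using assms by (auto simp: tmodule_transitive_iff)
  moreover have i: "i \<in> {0..<n}" using assms by auto
  moreover obtain x where "x \<in> ?M" "1 \<in> ?M" "x \<noteq> 1"
  proof
    show "(if i = 0 then 2 else 0) \<in> ?M" "1 \<in> ?M" "(if i = 0 then 2 else 0) \<noteq> (1::nat)"
      using assms by auto
  qed
  then have "?M \<noteq> {}" "\<not> (\<exists>v\<in>{0..<n}. ?M = {v})"
    by (blast, metis singletonD)
  moreover have "?M \<noteq> {0..<n}" using i by blast
  ultimately have "nontrivial_module (transitive_tournament {0..<n}) ?M"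
    unfolding nontrivial_module_def trivial_module_def by (simp add: transitive_tournament_def)
  then have "comodule (transitive_tournament {0..<n}) {i}"
    using i by (simp add: comodule_def transitive_tournament_def)
  moreover have "\<not> N \<subset> {i} \<or> N = {}" for N by blast
  ultimately show ?thesis unfolding mc_def using not_comodule_empty by blast
qed

lemma consecutive_in_mc:
  assumes "0 < i" "i + 2 < n"
  shows "{i, Suc i} \<in> mc (transitive_tournament {0..<n})"
proof -
  have "tmodule (transitive_tournament {0..<n}) {i, Suc i}"
    using assms by (auto simp: tmodule_transitive_iff)
  moreover have "0 \<notin> {i, Suc i}" "0 \<in> {0..<n}" using assms by auto
  ultimately have "comodule (transitive_tournament {0..<n}) {i, Suc i}"
    using assms by (auto simp: comodule_def nontrivial_module_def trivial_module_def transitive_tournament_def)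
  moreover have "\<not> comodule (transitive_tournament {0..<n}) Y" if "Y \<subset> {i, Suc i}" for Y
  proof -
    have "Y = {} \<or> Y = {i} \<or> Y = {Suc i}" using that by auto
    then show ?thesis using not_comodule_empty not_comodule_interior assms by auto
  qed
  ultimately show ?thesis by (auto simp: mc_def)
qed

lemma arc_Inv_iff:
  "(x, y) \<in> parcs (Inv (transitive_tournament {0..<n}) Q) \<longleftrightarrow>
    x < n \<and> y < n \<and> (if {x, y} \<in> Q then y < x else x < y)" for x y :: nat
  by (auto simp: Inv_def transitive_tournament_def insert_commute)

text \<open>If \<open>X\<close> misses every pair, no pair joins \<open>X\<close> to its complement,
  so inversion keeps all arcs between them and the underlying module survives.\<close>

lemma transversal_if_indecomposable:
  fixes n :: nat
  assumes "indecomposable (Inv (transitive_tournament {0..<n}) Q)"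
  shows "transversal (mc (transitive_tournament {0..<n})) (\<Union>Q)"
  unfolding transversal_def
proof (intro ballI notI)
  let ?V = "{0..<n}"
  fix X assume X: "X \<in> mc (transitive_tournament ?V)" and disj: "\<Union>Q \<inter> X = {}"
  then have XV: "X \<subseteq> ?V" by (auto simp: mc_def comodule_def transitive_tournament_def)
  obtain M where M: "M = X \<or> M = ?V - X" "nontrivial_module (transitive_tournament ?V) M"
    using X by (auto simp: mc_def comodule_def transitive_tournament_def)
  have "{v, x} \<notin> Q" if "v \<in> ?V - M" "x \<in> M" for v x
    using that M(1) disj XV by auto
  moreover have "\<And>v. v \<in> ?V - M \<Longrightarrow> (\<forall>x\<in>M. v < x) \<or> (\<forall>x\<in>M. x < v)" "M \<subseteq> ?V"
    using M(2) by (auto simp: nontrivial_module_def tmodule_transitive_iff)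
  ultimately have "tmodule (Inv (transitive_tournament ?V) Q) M"
    unfolding tmodule_def
    by (auto simp: subset_iff arc_Inv_iff insert_commute) (auto simp: Inv_def transitive_tournament_def)
  then show False
    using assms M(2)
    by (auto simp: indecomposable_def nontrivial_module_def trivial_module_def Inv_def)
qed

section \<open>Adjacency in a quasi-pairing\<close>

lemma quasi_pairing_Union: "quasi_pairing W Q \<Longrightarrow> \<Union>Q = W"
  by (auto simp: quasi_pairing_def)

lemma quasi_pairing_card: "quasi_pairing W Q \<Longrightarrow> e \<in> Q \<Longrightarrow> card e = 2"
  by (auto simp: quasi_pairing_def nsets_def)

lemma quasi_pairing_finite:
  assumes "quasi_pairing W Q"
  shows "finite Q" "finite W"
  using assms by (auto simp: quasi_pairing_def intro: card_ge_0_finite)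

lemma quasi_pairing_unique:
  assumes "quasi_pairing W Q" "{x, y} \<in> Q" "{x, z} \<in> Q" "x \<noteq> v_hat Q"
  shows "y = z"
proof (rule ccontr)
  assume "y \<noteq> z"
  then have "{x, y} \<noteq> {x, z}" by (auto simp: doubleton_eq_iff)
  then have "card {{x, y}, {x, z}} = 2" by simp
  moreover have "card {{x, y}, {x, z}} \<le> card {e \<in> Q. x \<in> e}"
    using assms(2,3) quasi_pairing_finite[OF assms(1)] by (intro card_mono) auto
  ultimately have "card {e \<in> Q. x \<in> e} \<noteq> 1" by simp
  moreover have "x \<in> W" using assms(2) quasi_pairing_Union[OF assms(1)] by auto
  ultimately have "card {e \<in> Q. x \<in> e} = 2"
    using quasi_pairing_card_2_ex1(2)[OF assms(1)] by blast
  then have "v_hat Q = x"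
    unfolding v_hat_def by (rule the1_equality[OF quasi_pairing_card_2_ex1(1)[OF assms(1)]])
  then show False using assms(4) by simp
qed

lemma quasi_pairing_hat_iff:
  fixes Q :: "'a::linorder set set"
  assumes "quasi_pairing W Q"
  shows "{v_hat Q, w} \<in> Q \<longleftrightarrow> w = v_minus Q \<or> w = v_plus Q"
  using quasi_pairing_v(1)[OF assms] by auto

lemma quasi_pairing_edgeE:
  assumes "quasi_pairing W Q" "e \<in> Q" "x \<in> e"
  obtains y where "e = {x, y}" "x \<noteq> y"
  using quasi_pairing_card[OF assms(1,2)] assms(3) by (auto simp: card_2_iff doubleton_eq_iff)

lemma Q_part_cases:
  fixes Q :: "'a::linorder set set"
  assumes qp: "quasi_pairing W Q" and "P \<in> Q_part Q" "x \<in> P"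
  obtains y where "P = {x, y}" "{x, y} \<in> Q" "x \<noteq> v_hat Q" "y \<noteq> v_hat Q"
  | "P = B_block Q"
proof (cases "P = B_block Q")
  case False
  then have P: "P \<in> Q" "P \<noteq> {v_hat Q, v_minus Q}" "P \<noteq> {v_hat Q, v_plus Q}"
    using assms(2) by (auto simp: Q_part_def)
  obtain y where y: "P = {x, y}" using quasi_pairing_edgeE[OF qp P(1) assms(3)] by blast
  have nh: "v_hat Q \<notin> P"
  proof
    assume "v_hat Q \<in> P"
    then obtain z where "P = {v_hat Q, z}" using quasi_pairing_edgeE[OF qp P(1)] by blast
    then show False using quasi_pairing_hat_iff[OF qp, of z] P by auto
  qed
  with y P(1) that(1)[of y] show thesis by auto
qed (use that in blast)

text \<open>Together with \<open>Q_part_cases\<close> this identifies the blocks as the connected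
  components of the graph with edge set \<open>Q\<close>.\<close>

lemma Q_part_closed:
  fixes Q :: "'a::linorder set set"
  assumes qp: "quasi_pairing W Q" and P: "P \<in> Q_part Q" "x \<in> P" and e: "{x, y} \<in> Q"
  shows "y \<in> P"
  using qp P
proof (cases rule: Q_part_cases)
  case (1 z)
  then show ?thesis using quasi_pairing_unique[OF qp _ e, of z] by auto
next
  case 2
  have "{v_hat Q, v_minus Q} \<in> Q" "{v_hat Q, v_plus Q} \<in> Q"
    using quasi_pairing_hat_iff[OF qp] by auto
  then have h: "{v_minus Q, v_hat Q} \<in> Q" "{v_plus Q, v_hat Q} \<in> Q"
    by (simp_all only: insert_commute)
  show ?thesis
  proof (cases "x = v_hat Q")
    case True
    then show ?thesis using e quasi_pairing_hat_iff[OF qp] 2 by (auto simp: B_block_def)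
  next
    case False
    then have "{x, v_hat Q} \<in> Q" using P(2) 2 h by (auto simp: B_block_def)
    then show ?thesis using quasi_pairing_unique[OF qp e _ False] 2 by (auto simp: B_block_def)
  qed
qed

lemma ex_Q_part:
  fixes Q :: "'a::linorder set set"
  assumes qp: "quasi_pairing W Q" and "e \<in> Q"
  shows "\<exists>P\<in>Q_part Q. e \<subseteq> P"
  using assms(2) by (auto simp: Q_part_def B_block_def)

lemma Q_part_partition:
  fixes Q :: "'a::linorder set set"
  assumes qp: "quasi_pairing W Q"
  shows "partition_on (\<Union>Q) (Q_part Q)"
proof (rule partition_onI)
  show "{} \<notin> Q_part Q"
    using quasi_pairing_card[OF qp, of "{}"] by (auto simp: Q_part_def B_block_def)
  have "{v_hat Q, v_minus Q} \<in> Q" "{v_hat Q, v_plus Q} \<in> Q"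
    using quasi_pairing_hat_iff[OF qp] by auto
  then have "B_block Q \<subseteq> \<Union>Q" by (auto simp: B_block_def)
  then have "\<Union>(Q_part Q) \<subseteq> \<Union>Q" by (auto simp: Q_part_def)
  moreover have "\<Union>Q \<subseteq> \<Union>(Q_part Q)" using ex_Q_part[OF qp] by blast
  ultimately show "\<Union>(Q_part Q) = \<Union>Q" ..
  show "disjnt p p'" if p: "p \<in> Q_part Q" "p' \<in> Q_part Q" "p \<noteq> p'" for p p'
  proof (rule ccontr)
    assume "\<not> disjnt p p'"
    then obtain x where x: "x \<in> p" "x \<in> p'" by (auto simp: disjnt_def)
    \<comment> \<open>Blocks are connected and closed under adjacency, so two blocks that meet
      contain each other.\<close>
    have sub: "r \<subseteq> s" if r: "r \<in> Q_part Q" and s: "s \<in> Q_part Q" and x: "x \<in> r" "x \<in> s" for r s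
      using qp r x(1)
    proof (cases rule: Q_part_cases)
      case (1 y)
      then show ?thesis using Q_part_closed[OF qp s x(2)] x(2) by auto
    next
      case 2
      have h: "{v_hat Q, v_minus Q} \<in> Q" "{v_hat Q, v_plus Q} \<in> Q"
        using quasi_pairing_hat_iff[OF qp] by auto
      then have "x = v_hat Q \<or> {x, v_hat Q} \<in> Q"
        using x(1) 2 by (auto simp: B_block_def insert_commute)
      then have "v_hat Q \<in> s" using Q_part_closed[OF qp s x(2)] x(2) by auto
      then show ?thesis using Q_part_closed[OF qp s] h 2 by (auto simp: B_block_def)
    qed
    then show False using p x by blast
  qed
qed

lemma near_matching_quasi_pairing:
  fixes Q :: "nat set set"
  assumes qp: "quasi_pairing W Q" and W: "W \<subseteq> {..N}"
  shows "near_matching N (\<lambda>x y. {x, y} \<in> Q) (v_hat Q)"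
proof
  show "{y, x} \<in> Q" if "{x, y} \<in> Q" for x y using that by (simp add: insert_commute)
  show "{x, x} \<notin> Q" for x using quasi_pairing_card[OF qp, of "{x, x}"] by auto
  show "x \<le> N" if "{x, y} \<in> Q" for x y
    using that W quasi_pairing_Union[OF qp] by auto
  show "v_hat Q \<le> N"
    using quasi_pairing_hat_iff[OF qp, of "v_plus Q"] W quasi_pairing_Union[OF qp] by auto
  show "y = z" if "{x, y} \<in> Q" "{x, z} \<in> Q" "x \<noteq> v_hat Q" for x y z
    using quasi_pairing_unique[OF qp] that by blast
  show "x = y \<or> x = z \<or> y = z"
    if "{v_hat Q, x} \<in> Q" "{v_hat Q, y} \<in> Q" "{v_hat Q, z} \<in> Q" for x y z
    using that unfolding quasi_pairing_hat_iff[OF qp] by auto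
qed

section \<open>Transfer between quasi-pairings and the abstract adjacency relation\<close>

locale quasi_pairing_upto =
  fixes N :: nat and Q :: "nat set set" and W
  assumes qp: "quasi_pairing W Q" and W_le: "W \<subseteq> {..N}"
begin

sublocale near_matching N "\<lambda>x y. {x, y} \<in> Q" "v_hat Q"
  using near_matching_quasi_pairing qp W_le .

lemma covered_iff: "covered x \<longleftrightarrow> x \<in> \<Union>Q"
proof
  assume "x \<in> \<Union>Q"
  then obtain e where "e \<in> Q" "x \<in> e" by blast
  then show "covered x" using quasi_pairing_edgeE[OF qp] unfolding covered_def by metis
qed (auto simp: covered_def)

lemma tmodule_iff_homogeneous:
  "tmodule (Inv (transitive_tournament {0..<Suc N}) Q) M \<longleftrightarrow> homogeneous M"
proof -
  have "({v} \<times> M \<subseteq> parcs (Inv (transitive_tournament {0..<Suc N}) Q) \<longleftrightarrow> (\<forall>x\<in>M. {v, x} \<in> Q \<longleftrightarrow> x < v))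
    \<and> (M \<times> {v} \<subseteq> parcs (Inv (transitive_tournament {0..<Suc N}) Q) \<longleftrightarrow> (\<forall>x\<in>M. {v, x} \<in> Q \<longleftrightarrow> v < x))"
    if "M \<subseteq> {..N}" "v \<in> {..N} - M" for v
  proof -
    have *: "(v, x) \<in> parcs (Inv (transitive_tournament {0..<Suc N}) Q) \<longleftrightarrow> ({v, x} \<in> Q \<longleftrightarrow> x < v)"
      "(x, v) \<in> parcs (Inv (transitive_tournament {0..<Suc N}) Q) \<longleftrightarrow> ({v, x} \<in> Q \<longleftrightarrow> v < x)" if "x \<in> M" for x
    proof -
      have "x < Suc N" "v < Suc N" "x < v \<or> v < x"
        using that \<open>M \<subseteq> {..N}\<close> \<open>v \<in> {..N} - M\<close> by (auto simp: less_Suc_eq_le intro: linorder_cases[of x v])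
      then show "(v, x) \<in> parcs (Inv (transitive_tournament {0..<Suc N}) Q) \<longleftrightarrow> ({v, x} \<in> Q \<longleftrightarrow> x < v)"
        "(x, v) \<in> parcs (Inv (transitive_tournament {0..<Suc N}) Q) \<longleftrightarrow> ({v, x} \<in> Q \<longleftrightarrow> v < x)"
        unfolding arc_Inv_iff insert_commute[of x v] by auto
    qed
    show ?thesis using * by blast
  qed
  moreover have "pverts (Inv (transitive_tournament {0..<Suc N}) Q) = {..N}"
    by (auto simp: Inv_def transitive_tournament_def)
  ultimately show ?thesis
    unfolding tmodule_def homogeneous_def by (metis (no_types, lifting))
qed

lemma indecomposable_iff_prime:
  "indecomposable (Inv (transitive_tournament {0..<Suc N}) Q) \<longleftrightarrow> prime"
proof -
  have "pverts (Inv (transitive_tournament {0..<Suc N}) Q) = {..N}"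
    by (auto simp: Inv_def transitive_tournament_def)
  then show ?thesis
    by (simp add: indecomposable_def prime_def trivial_module_def tmodule_iff_homogeneous)
qed

text \<open>The covered points of a closed interval form an interval of \<open>\<Union>Q\<close>
  that is a union of blocks. It contains \<open>x\<close> and a partner of \<open>x\<close>, so
  irreducibility makes it all of \<open>\<Union>Q\<close>, including \<open>0\<close> and
  \<open>N\<close>.\<close>

lemma closed_interval_full_if_irreducible:
  assumes irr: "irreducible_partition (\<Union>Q) (Q_part Q)"
    and ends: "0 \<in> \<Union>Q" "N \<in> \<Union>Q"
    and c: "closed_interval i j" "x \<in> {i..j}" "covered x"
  shows "i = 0 \<and> j = N"
proof -
  define I where "I = \<Union>Q \<inter> {i..j}"
  define \<B> where "\<B> = {P \<in> Q_part Q. P \<subseteq> {i..j}}"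
  have closed: "v \<in> {i..j}" if "{u, v} \<in> Q" "u \<in> {i..j}" for u v
    using c(1) that unfolding closed_interval_def by blast
  have part: "partition_on (\<Union>Q) (Q_part Q)" by (rule Q_part_partition[OF qp])
  have sub: "P \<subseteq> {i..j}" if P: "P \<in> Q_part Q" and u: "u \<in> P" "u \<in> {i..j}" for P u
    using qp P u(1)
  proof (cases rule: Q_part_cases)
    case (1 y)
    then show ?thesis using closed u by auto
  next
    case 2
    have h: "{v_hat Q, v_minus Q} \<in> Q" "{v_hat Q, v_plus Q} \<in> Q"
      using quasi_pairing_hat_iff[OF qp] by auto
    then have "u = v_hat Q \<or> {u, v_hat Q} \<in> Q"
      using u(1) 2 by (auto simp: B_block_def insert_commute)
    then have "v_hat Q \<in> {i..j}" using closed u by blast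
    moreover from this have "v_minus Q \<in> {i..j}" "v_plus Q \<in> {i..j}" using closed h by blast+
    ultimately show ?thesis using 2 by (simp add: B_block_def)
  qed
  have "I = \<Union>\<B>"
  proof
    show "I \<subseteq> \<Union>\<B>"
    proof
      fix u assume u: "u \<in> I"
      then have "u \<in> \<Union>(Q_part Q)" unfolding I_def partition_onD1[OF part, symmetric] by simp
      then obtain P where "P \<in> Q_part Q" "u \<in> P" by blast
      then show "u \<in> \<Union>\<B>" using sub[of P u] u unfolding I_def \<B>_def by blast
    qed
    have "\<Union>\<B> \<subseteq> \<Union>Q" unfolding partition_onD1[OF part] \<B>_def by blast
    then show "\<Union>\<B> \<subseteq> I" unfolding I_def \<B>_def by blast
  qed
  moreover have "interval (\<Union>Q) I"
    by (auto simp: interval_def I_def)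
  moreover have "x \<in> I" using c covered_iff by (simp add: I_def)
  moreover obtain y where "{x, y} \<in> Q" using c(3) by (auto simp: covered_def)
  then have "y \<in> I" "x \<noteq> y" using closed[of x y] c(2) E_irrefl by (auto simp: I_def)
  moreover have "\<B> \<subseteq> Q_part Q" by (auto simp: \<B>_def)
  ultimately have *: "interval (\<Union>Q) I" "I \<noteq> {}" "\<not> is_singleton I" "\<exists>\<B>\<subseteq>Q_part Q. I = \<Union>\<B>"
    by (blast, blast, metis is_singletonE singletonD, blast)
  have "I = \<Union>Q"
    by (rule ccontr) (use irr * in \<open>unfold irreducible_partition_def nontrivial_interval_def, metis\<close>)
  then have "\<Union>Q \<subseteq> {i..j}" unfolding I_def by blast
  then have "0 \<in> {i..j}" "N \<in> {i..j}" using ends by blast+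
  then show ?thesis using c(1) by (auto simp: closed_interval_def)
qed

lemma irreducible_if_prime:
  assumes prime
  shows "irreducible_partition (\<Union>Q) (Q_part Q)"
  unfolding irreducible_partition_def
proof (intro conjI notI)
  show "partition_on (\<Union>Q) (Q_part Q)" by (rule Q_part_partition[OF qp])
  assume "\<exists>I. nontrivial_interval (\<Union>Q) I \<and> (\<exists>\<B>\<subseteq>Q_part Q. I = \<Union>\<B>)"
  then obtain I \<B> where I: "interval (\<Union>Q) I" "I \<noteq> {}" "\<not> is_singleton I" "I \<noteq> \<Union>Q"
    and B: "\<B> \<subseteq> Q_part Q" "I = \<Union>\<B>"
    unfolding nontrivial_interval_def by blast
  \<comment> \<open>\<open>I\<close> is an interval of \<open>\<Union>Q\<close> only; its convex
    hull in \<open>{..N}\<close> adds uncovered points alone, so still no pair leaves it.\<close>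
  define M where "M = {x. \<exists>y\<in>I. \<exists>z\<in>I. y \<le> x \<and> x \<le> z}"
  have IQ: "I \<subseteq> \<Union>Q" using I(1) by (simp add: interval_def)
  then have IN: "x \<le> N" if "x \<in> I" for x using that W_le quasi_pairing_Union[OF qp] by blast
  have MQ: "x \<in> I" if "x \<in> M" "x \<in> \<Union>Q" for x
    using that I(1) unfolding M_def interval_def by (smt (verit) DiffI linorder_not_less mem_Collect_eq)
  have closed: "y \<in> I" if "x \<in> I" "{x, y} \<in> Q" for x y
    using that B Q_part_closed[OF qp] by blast
  have IM: "I \<subseteq> M" by (auto simp: M_def)
  have "homogeneous M"
    unfolding homogeneous_def
  proof (intro conjI ballI)
    show "M \<subseteq> {..N}" using IN by (fastforce simp: M_def)
    fix v assume v: "v \<in> {..N} - M"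
    have "{v, x} \<notin> Q" if "x \<in> M" for x
    proof
      assume e: "{v, x} \<in> Q"
      then have "x \<in> I" using MQ[OF that] by auto
      then have "v \<in> I" using closed[of x v] e by (simp add: insert_commute)
      then show False using IM v by blast
    qed
    moreover have "(\<forall>x\<in>M. v < x) \<or> (\<forall>x\<in>M. x < v)"
    proof (rule ccontr)
      assume "\<not> ?thesis"
      then obtain x y where "x \<in> M" "x \<le> v" "y \<in> M" "v \<le> y" by (meson linorder_not_less)
      then have "v \<in> M" unfolding M_def by (blast intro: order_trans)
      then show False using v by blast
    qed
    ultimately show "(\<forall>x\<in>M. {v, x} \<in> Q \<longleftrightarrow> x < v) \<or> (\<forall>x\<in>M. {v, x} \<in> Q \<longleftrightarrow> v < x)"
      by (metis order_less_asym)
  qed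
  moreover obtain x y where "x \<in> I" "y \<in> I" "x \<noteq> y"
    using I(2,3) by (metis is_singletonI' equals0I)
  moreover obtain z where "z \<in> \<Union>Q" "z \<notin> I" using I(4) IQ by blast
  moreover from this have "z \<notin> M" "z \<le> N"
    using MQ W_le quasi_pairing_Union[OF qp] by blast+
  ultimately show False using not_prime IM assms by blast
qed

text \<open>Of the transversal condition only the minimal co-modules \<open>{0}\<close>,
  \<open>{N}\<close> and \<open>{i, Suc i}\<close> are used, to supply the covering axioms of
  \<open>admissible\<close>.\<close>

lemma prime_if_conditions:
  assumes N: "4 \<le> N"
    and trans: "transversal (mc (transitive_tournament {0..<Suc N})) (\<Union>Q)"
    and irr: "irreducible_quasi_pairing (\<Union>Q) Q"
    and gap: "v_minus Q + 2 \<le> v_plus Q"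
    and cross: "\<forall>v\<in>{0..<Suc N}. {{v, v + 2}, {v + 1, v + 3}} \<subseteq> Q \<longrightarrow> v_hat Q \<in> {v, v + 3}"
    and cons: "\<forall>v\<in>{0..<Suc N}. {v, v + 1} \<in> Q \<longrightarrow>
       v_hat Q \<in> {v, v + 1} \<and> v_hat Q \<ge> 1 \<and> {v_hat Q - 1, v_hat Q + 1} \<subseteq> \<Union>Q"
  shows prime
proof -
  have ends: "0 \<in> \<Union>Q" "N \<in> \<Union>Q"
    using trans end_in_mc[of "Suc N" 0] end_in_mc[of "Suc N" N] N
    unfolding transversal_def by force+
  have step: "i \<in> \<Union>Q \<or> Suc i \<in> \<Union>Q" if "i < N" for i
  proof (cases "i = 0 \<or> Suc i = N")
    case True
    then show ?thesis using ends by auto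
  next
    case False
    then have "{i, Suc i} \<in> mc (transitive_tournament {0..<Suc N})"
      using that by (intro consecutive_in_mc) auto
    then have "\<Union>Q \<inter> {i, Suc i} \<noteq> {}" using trans unfolding transversal_def by (metis (no_types))
    then show ?thesis by auto
  qed
  interpret admissible N "\<lambda>x y. {x, y} \<in> Q" "v_hat Q"
  proof
    show "4 \<le> N" by (fact N)
    show "covered 0" "covered N" using ends covered_iff by auto
    show "covered i \<or> covered (Suc i)" if "i < N" for i using step[OF that] covered_iff by auto
    show "i = 0 \<and> j = N" if "closed_interval i j" "x \<in> {i..j}" "covered x" for i j x
      using closed_interval_full_if_irreducible ends irr that
      unfolding irreducible_quasi_pairing_def by blast
    show "{v_hat Q, Suc y} \<notin> Q" if "{v_hat Q, y} \<in> Q" for y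
      using that gap unfolding quasi_pairing_hat_iff[OF qp] by auto
    show "v_hat Q = v \<or> v_hat Q = v + 3" if "{v, v + 2} \<in> Q" "{v + 1, v + 3} \<in> Q" for v
      using cross that E_le[OF that(1)] by auto
    show "(v_hat Q = v \<or> v_hat Q = Suc v) \<and> 1 \<le> v_hat Q \<and> covered (v_hat Q - 1) \<and> covered (Suc (v_hat Q))"
      if "{v, Suc v} \<in> Q" for v
      using bspec[OF cons, of v] that E_le[OF that] unfolding covered_iff by simp
  qed
  show ?thesis
    unfolding prime_def
  proof (intro allI impI)
    fix M assume M: "homogeneous M"
    then have "M \<subseteq> {..N}" by (simp add: homogeneous_def)
    then show "M = {} \<or> M = {..N} \<or> (\<exists>v\<in>{..N}. M = {v})"
      using homogeneous_trivial[OF M] by (metis is_singletonI' is_singleton_def insert_subset)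
  qed
qed

end

theorem theorem3p3:
  fixes n :: nat and Q :: "nat set set"
  assumes "n \<ge> 5"
    and "partial_quasi_pairing {0..<n} Q"
  shows "indecomposable (Inv (transitive_tournament {0..<n}) Q) \<longleftrightarrow>
    (transversal (mc (transitive_tournament {0..<n})) (\<Union>Q) \<and> irreducible_quasi_pairing (\<Union>Q) Q) \<and>
    v_plus Q \<ge> v_minus Q + 2 \<and>
    (\<forall>v\<in>{0..<n}. {{v, v + 2}, {v + 1, v + 3}} \<subseteq> Q \<longrightarrow> v_hat Q \<in> {v, v + 3}) \<and>
    (\<forall>v\<in>{0..<n}. {v, v + 1} \<in> Q \<longrightarrow>
       v_hat Q \<in> {v, v + 1} \<and> v_hat Q \<ge> 1 \<and> {v_hat Q - 1, v_hat Q + 1} \<subseteq> \<Union>Q)"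
    (is "?indec \<longleftrightarrow> ?rhs")
proof -
  define N where "N = n - 1"
  have n: "n = Suc N" and N: "4 \<le> N" using assms(1) by (auto simp: N_def)
  obtain W where "W \<subseteq> {0..<n}" "quasi_pairing W Q"
    using assms(2) by (auto simp: partial_quasi_pairing_def)
  then interpret quasi_pairing_upto N Q W by unfold_locales (auto simp: n)
  show ?thesis
  proof
    assume indec: ?indec
    then have prime using indecomposable_iff_prime n by simp
    have "transversal (mc (transitive_tournament {0..<n})) (\<Union>Q)"
      using transversal_if_indecomposable indec .
    moreover have "irreducible_quasi_pairing (\<Union>Q) Q"
      using irreducible_if_prime[OF \<open>prime\<close>] qp quasi_pairing_Union[OF qp]
      by (simp add: irreducible_quasi_pairing_def)
    moreover have "v_plus Q \<ge> v_minus Q + 2"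
    proof -
      have "v_plus Q \<noteq> Suc (v_minus Q)"
        using prime_hat_gap[OF \<open>prime\<close>, of "v_minus Q"] N quasi_pairing_hat_iff[OF qp] by auto
      then show ?thesis using quasi_pairing_v(2)[OF qp] by simp
    qed
    moreover have "\<forall>v\<in>{0..<n}. {{v, v + 2}, {v + 1, v + 3}} \<subseteq> Q \<longrightarrow> v_hat Q \<in> {v, v + 3}"
      using prime_crossing[OF \<open>prime\<close>] by simp
    moreover have "\<forall>v\<in>{0..<n}. {v, v + 1} \<in> Q \<longrightarrow>
       v_hat Q \<in> {v, v + 1} \<and> v_hat Q \<ge> 1 \<and> {v_hat Q - 1, v_hat Q + 1} \<subseteq> \<Union>Q"
      using prime_consecutive[OF \<open>prime\<close>] N unfolding covered_iff by simp
    ultimately show ?rhs by blast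
  next
    assume ?rhs
    then have prime unfolding n by (intro prime_if_conditions[OF N]) blast+
    then show ?indec using indecomposable_iff_prime n by simp
  qed
qed

end
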